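(* Let $\mathcal W=((W_i,c_i))_{i\in I}$ be a fusion frame for $\mathcal H$ and let $\mathcal V=((V_i,d_i))_{i\in I}$ be a Bessel fusion sequence in $\mathcal H$. Then the following statements are equivalent: (i) $\mathcal V$ is a fusion frame dual of $\mathcal W$. (ii) There exists a sequence $(Q_i)_{i\in I}\subset\mathcal B(\mathcal H)$ satisfying, for each $i\in I$, $W_i^\perp\subset\ker Q_i$, $\operatorname{ran}Q_i\subset V_i$, and $\|Q_i\|=1$ if $i\notin I_0(\mathcal V,\mathcal W)$, such that $(d_iQ_i^* )_{i\in I}$ is a $\mathcal B(\mathcal H)$-valued dual of $(c_iP_{W_i})_{i\in I}$. (iii) There exists a $\mathcal B(\mathcal H)$-valued Bessel sequence $\mathcal L=(L_i)_{i\in I}\subset\mathcal B(\mathcal H)$ with $T_{\mathcal L}^*T_{\mathcal W}=0$ such that for the operators $A_i:=(c_iS_{\mathcal W}^{-1}+L_i^* )P_{W_i}$, $i\in I$, we have $\operatorname{ran}A_i\subset V_i$ and, if $i\notin I_0(\mathcal V,\mathcal W)$, $\|A_i\|=d_i$.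
   Context: $\mathcal H$ is a Hilbert space, $I\subset\mathbb N$ a finite or countable index set, $\mathcal B(\mathcal H)$ the bounded operators on $\mathcal H$, $P_V$ the orthogonal projection onto a closed subspace $V$. A sequence $\mathcal A=(A_i)_{i\in I}\subset\mathcal B(\mathcal H)$ is a $\mathcal B(\mathcal H)$-valued Bessel sequence if there is $\beta>0$ with $\sum_{i\in I}\|A_ix\|^2\le\beta\|x\|^2$ for all $x\in\mathcal H$; its analysis operator is $T_{\mathcal A}:\mathcal H\to\ell^2(I,\mathcal H)$, $T_{\mathcal A}x=(A_ix)_{i\in I}$. It is a $\mathcal B(\mathcal H)$-valued frame for $\mathcal H$ if in addition, for some $\alpha>0$, $\alpha\|x\|^2\le\sum_{i\in I}\|A_ix\|^2$ for all $x\in\mathcal H$. A $\mathcal B(\mathcal H)$-valued dual of a $\mathcal B(\mathcal H)$-valued frame $(A_i)_{i\in I}$ for $\mathcal H$ is a $\mathcal B(\mathcal H)$-valued Bessel sequence $(\widetilde A_i)_{i\in I}$ with $\sum_{i\in I}\widetilde A_i^*A_ix=x$ for all $x\in\mathcal H$. A fusion sequence is a sequence of pairs $\mathcal W=((W_i,c_i))_{i\in I}$ of closed subspaces $W_i\subset\mathcal H$ and real numbers $c_i\ge0$ such that $W_i=\{0\}\Leftrightarrow c_i=0$. It is a Bessel fusion sequence (resp. a fusion frame for $\mathcal H$) if $(c_iP_{W_i})_{i\in I}$ is a $\mathcal B(\mathcal H)$-valued Bessel sequence (resp. frame for $\mathcal H$). In this case $T_{\mathcal W}x:=(c_iP_{W_i}x)_{i\in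 I}$ and $S_{\mathcal W}:=T_{\mathcal W}^*T_{\mathcal W}$, which is boundedly invertible for a fusion frame. For fusion sequences $\mathcal V=((V_i,d_i))_{i\in I}$, $\mathcal W=((W_i,c_i))_{i\in I}$ put $I_0(\mathcal V,\mathcal W):=\{i\in I: V_i=\{0\}\text{ or }W_i=\{0\}\}$. A Bessel fusion sequence $\mathcal V=((V_i,d_i))_{i\in I}$ is a fusion frame dual (FF-dual) of the fusion frame $\mathcal W=((W_i,c_i))_{i\in I}$ if there exists a sequence $(Q_i)_{i\in I}\subset\mathcal B(\mathcal H)$ such that for each $i\in I$: $W_i^\perp\subset\ker Q_i$, $\operatorname{ran}Q_i\subset V_i$, and $\|Q_i\|=1$ if $i\notin I_0(\mathcal V,\mathcal W)$; and $x=\sum_{i\in I}c_id_iQ_ix$ for all $x\in\mathcal H$. *)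

theory Defs
  imports "HOL-Analysis.Analysis"
begin

text \<open>
  The scalar field is \<open>\<real>\<close> or \<open>\<complex>\<close>. Every element \<open>x\<close> of a model of the following class is a root of
  \<open>t\<^sup>2 - 2 Re(x) t + |x|\<^sup>2\<close>, so \<open>\<real>\<close> and \<open>\<complex>\<close> with their usual conjugations are its only models.
\<close>

class rc_field = real_normed_field + banach +
  fixes conjg :: "'a \<Rightarrow> 'a" and re_part :: "'a \<Rightarrow> real"
  assumes conjg_add: "conjg (x + y) = conjg x + conjg y"
    and conjg_mult: "conjg (x * y) = conjg x * conjg y"
    and conjg_scaleR_one: "conjg (r *\<^sub>R 1) = r *\<^sub>R 1"
    and add_conjg: "x + conjg x = (2 * re_part x) *\<^sub>R 1"
    and mult_conjg: "x * conjg x = (norm x)\<^sup>2 *\<^sub>R 1"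

instantiation real :: rc_field
begin
definition conjg_real :: "real \<Rightarrow> real" where "conjg_real x = x"
definition re_part_real :: "real \<Rightarrow> real" where "re_part_real x = x"
instance
  by standard (simp_all add: conjg_real_def re_part_real_def power2_eq_square)
end

instantiation complex :: rc_field
begin
definition conjg_complex :: "complex \<Rightarrow> complex" where "conjg_complex = cnj"
definition re_part_complex :: "complex \<Rightarrow> real" where "re_part_complex = Re"
instance
proof
  fix x y :: complex and r :: real
  show "conjg (x + y) = conjg x + conjg y" "conjg (x * y) = conjg x * conjg y"
    "conjg (r *\<^sub>R 1 :: complex) = r *\<^sub>R 1"
    by (simp_all add: conjg_complex_def)
  show "x + conjg x = (2 * re_part x) *\<^sub>R 1"
    by (simp add: conjg_complex_def re_part_complex_def complex_eq_iff)
  show "x * conjg x = (norm x)\<^sup>2 *\<^sub>R 1"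
    by (simp only: conjg_complex_def complex_norm_square [symmetric] scaleR_conv_of_real mult_1_right)
qed
end

text \<open>
  A real or complex Hilbert space, carried by a type. The classes of the carrier supply the
  underlying real Hilbert space, hence the norm, the topology and completeness;
  \<open>inner_re_part\<close> says that this norm is the one induced by the \<open>'k\<close>-valued inner product
  \<open>ip\<close>, which is linear in its first argument.
\<close>

locale hilbert_space = vector_space scale
  for scale :: "'k::rc_field \<Rightarrow> 'h::{real_inner,banach} \<Rightarrow> 'h" +
  fixes ip :: "'h \<Rightarrow> 'h \<Rightarrow> 'k"
  assumes scale_of_real: "scale (of_real r) x = r *\<^sub>R x"
    and ip_add_left: "ip (x + y) z = ip x z + ip y z"
    and ip_scale_left: "ip (scale a x) y = a * ip x y"
    and ip_commute: "ip y x = conjg (ip x y)"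
    and inner_re_part: "inner x y = re_part (ip x y)"

lemma hilbert_space_real:
  "hilbert_space (scaleR :: real \<Rightarrow> 'h::{real_inner,banach} \<Rightarrow> 'h) inner"
  by unfold_locales
    (simp_all add: conjg_real_def re_part_real_def inner_commute inner_add_left inner_add_right
      scaleR_add_left scaleR_add_right)

lemma hilbert_space_complex:
  "hilbert_space ((*) :: complex \<Rightarrow> complex \<Rightarrow> complex) (\<lambda>x y. x * cnj y)"
  by unfold_locales
    (simp_all add: conjg_complex_def re_part_complex_def inner_complex_def scaleR_conv_of_real
      distrib_left distrib_right)

subsection \<open>Subspaces and operators\<close>

definition closed_subspace :: "('k::rc_field \<Rightarrow> 'h::{real_inner,banach} \<Rightarrow> 'h) \<Rightarrow> 'h set \<Rightarrow> bool"
  where "closed_subspace s V \<longleftrightarrow> module.subspace s V \<and> closed V"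

definition bounded_op ::
    "('k::rc_field \<Rightarrow> 'h::{real_inner,banach} \<Rightarrow> 'h) \<Rightarrow> ('h \<Rightarrow> 'h) \<Rightarrow> bool"
  where "bounded_op s A \<longleftrightarrow> Vector_Spaces.linear s s A \<and> bounded_linear A"

definition ortho :: "('h::{real_inner,banach} \<Rightarrow> 'h \<Rightarrow> 'k::rc_field) \<Rightarrow> 'h set \<Rightarrow> 'h set"
  where "ortho ip V = {x. \<forall>v\<in>V. ip x v = 0}"

definition proj :: "('h::{real_inner,banach} \<Rightarrow> 'h \<Rightarrow> 'k::rc_field) \<Rightarrow> 'h set \<Rightarrow> 'h \<Rightarrow> 'h"
  where "proj ip V x = (THE y. y \<in> V \<and> x - y \<in> ortho ip V)"

definition adj :: "('h::{real_inner,banach} \<Rightarrow> 'h \<Rightarrow> 'k::rc_field) \<Rightarrow> ('h \<Rightarrow> 'h) \<Rightarrow> 'h \<Rightarrow> 'h"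
  where "adj ip A y = (THE z. \<forall>x. ip (A x) y = ip x z)"

subsection \<open>The analysis operator and its adjoint\<close>

text \<open>
  Elements of \<open>\<ell>\<^sup>2(I, H)\<close> are represented by the functions that vanish off \<open>I\<close> and whose squared
  norms are summable over \<open>I\<close>. \<open>l2_adj ip I T\<close> is the Hilbert space adjoint
  \<open>\<ell>\<^sup>2(I, H) \<rightarrow> H\<close> of \<open>T : H \<rightarrow> \<ell>\<^sup>2(I, H)\<close>; its values at functions outside
  \<open>\<ell>\<^sup>2(I, H)\<close> are meaningless.
\<close>

definition l2_ip ::
    "('h::{real_inner,banach} \<Rightarrow> 'h \<Rightarrow> 'k::rc_field) \<Rightarrow> nat set \<Rightarrow> (nat \<Rightarrow> 'h) \<Rightarrow> (nat \<Rightarrow> 'h) \<Rightarrow> 'k"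
  where "l2_ip ip I f g = (\<Sum>\<^sub>\<infinity>i\<in>I. ip (f i) (g i))"

definition l2_adj ::
    "('h::{real_inner,banach} \<Rightarrow> 'h \<Rightarrow> 'k::rc_field) \<Rightarrow> nat set \<Rightarrow> ('h \<Rightarrow> nat \<Rightarrow> 'h) \<Rightarrow> (nat \<Rightarrow> 'h) \<Rightarrow> 'h"
  where "l2_adj ip I T f = (THE y. \<forall>x. l2_ip ip I (T x) f = ip x y)"

definition analysis_op :: "nat set \<Rightarrow> (nat \<Rightarrow> 'h \<Rightarrow> 'h::{real_inner,banach}) \<Rightarrow> 'h \<Rightarrow> nat \<Rightarrow> 'h"
  where "analysis_op I A x = (\<lambda>i. if i \<in> I then A i x else 0)"

subsection \<open>Operator-valued frames\<close>

definition op_bessel ::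
    "('k::rc_field \<Rightarrow> 'h::{real_inner,banach} \<Rightarrow> 'h) \<Rightarrow> nat set \<Rightarrow> (nat \<Rightarrow> 'h \<Rightarrow> 'h) \<Rightarrow> bool"
  where "op_bessel s I A \<longleftrightarrow>
    (\<forall>i\<in>I. bounded_op s (A i)) \<and>
    (\<exists>\<beta>>0. \<forall>x. (\<lambda>i. (norm (A i x))\<^sup>2) summable_on I \<and>
                (\<Sum>\<^sub>\<infinity>i\<in>I. (norm (A i x))\<^sup>2) \<le> \<beta> * (norm x)\<^sup>2)"

definition op_frame ::
    "('k::rc_field \<Rightarrow> 'h::{real_inner,banach} \<Rightarrow> 'h) \<Rightarrow> nat set \<Rightarrow> (nat \<Rightarrow> 'h \<Rightarrow> 'h) \<Rightarrow> bool"
  where "op_frame s I A \<longleftrightarrow>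
    op_bessel s I A \<and>
    (\<exists>\<alpha>>0. \<forall>x. \<alpha> * (norm x)\<^sup>2 \<le> (\<Sum>\<^sub>\<infinity>i\<in>I. (norm (A i x))\<^sup>2))"

text \<open>\<open>op_dual s ip I B A\<close>: the sequence \<open>B\<close> is a dual of the frame \<open>A\<close>.\<close>

definition op_dual ::
    "('k::rc_field \<Rightarrow> 'h::{real_inner,banach} \<Rightarrow> 'h) \<Rightarrow> ('h \<Rightarrow> 'h \<Rightarrow> 'k) \<Rightarrow> nat set \<Rightarrow>
      (nat \<Rightarrow> 'h \<Rightarrow> 'h) \<Rightarrow> (nat \<Rightarrow> 'h \<Rightarrow> 'h) \<Rightarrow> bool"
  where "op_dual s ip I B A \<longleftrightarrow>
    op_frame s I A \<and> op_bessel s I B \<and>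
    (\<forall>x. ((\<lambda>i. adj ip (B i) (A i x)) has_sum x) I)"

subsection \<open>Fusion frames\<close>

definition fusion_seq ::
    "('k::rc_field \<Rightarrow> 'h::{real_inner,banach} \<Rightarrow> 'h) \<Rightarrow> nat set \<Rightarrow> (nat \<Rightarrow> 'h set) \<Rightarrow> (nat \<Rightarrow> real) \<Rightarrow> bool"
  where "fusion_seq s I W c \<longleftrightarrow>
    (\<forall>i\<in>I. closed_subspace s (W i) \<and> 0 \<le> c i \<and> (W i = {0} \<longleftrightarrow> c i = 0))"

definition fusion_ops ::
    "('h::{real_inner,banach} \<Rightarrow> 'h \<Rightarrow> 'k::rc_field) \<Rightarrow> (nat \<Rightarrow> 'h set) \<Rightarrow> (nat \<Rightarrow> real) \<Rightarrow> nat \<Rightarrow> 'h \<Rightarrow> 'h"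
  where "fusion_ops ip W c i x = c i *\<^sub>R proj ip (W i) x"

definition bessel_fusion_seq ::
    "('k::rc_field \<Rightarrow> 'h::{real_inner,banach} \<Rightarrow> 'h) \<Rightarrow> ('h \<Rightarrow> 'h \<Rightarrow> 'k) \<Rightarrow> nat set \<Rightarrow>
      (nat \<Rightarrow> 'h set) \<Rightarrow> (nat \<Rightarrow> real) \<Rightarrow> bool"
  where "bessel_fusion_seq s ip I W c \<longleftrightarrow>
    fusion_seq s I W c \<and> op_bessel s I (fusion_ops ip W c)"

definition fusion_frame ::
    "('k::rc_field \<Rightarrow> 'h::{real_inner,banach} \<Rightarrow> 'h) \<Rightarrow> ('h \<Rightarrow> 'h \<Rightarrow> 'k) \<Rightarrow> nat set \<Rightarrow>
      (nat \<Rightarrow> 'h set) \<Rightarrow> (nat \<Rightarrow> real) \<Rightarrow> bool"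
  where "fusion_frame s ip I W c \<longleftrightarrow>
    fusion_seq s I W c \<and> op_frame s I (fusion_ops ip W c)"

definition fusion_analysis ::
    "('h::{real_inner,banach} \<Rightarrow> 'h \<Rightarrow> 'k::rc_field) \<Rightarrow> nat set \<Rightarrow> (nat \<Rightarrow> 'h set) \<Rightarrow> (nat \<Rightarrow> real) \<Rightarrow>
      'h \<Rightarrow> nat \<Rightarrow> 'h"
  where "fusion_analysis ip I W c = analysis_op I (fusion_ops ip W c)"

definition fusion_frame_op ::
    "('h::{real_inner,banach} \<Rightarrow> 'h \<Rightarrow> 'k::rc_field) \<Rightarrow> nat set \<Rightarrow> (nat \<Rightarrow> 'h set) \<Rightarrow> (nat \<Rightarrow> real) \<Rightarrow>
      'h \<Rightarrow> 'h"
  where "fusion_frame_op ip I W c =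
    l2_adj ip I (fusion_analysis ip I W c) \<circ> fusion_analysis ip I W c"

definition zero_indices ::
    "nat set \<Rightarrow> (nat \<Rightarrow> 'h::{real_inner,banach} set) \<Rightarrow> (nat \<Rightarrow> 'h set) \<Rightarrow> nat set"
  where "zero_indices I V W = {i\<in>I. V i = {0} \<or> W i = {0}}"

definition dual_ops ::
    "('k::rc_field \<Rightarrow> 'h::{real_inner,banach} \<Rightarrow> 'h) \<Rightarrow> ('h \<Rightarrow> 'h \<Rightarrow> 'k) \<Rightarrow> nat set \<Rightarrow>
      (nat \<Rightarrow> 'h set) \<Rightarrow> (nat \<Rightarrow> 'h set) \<Rightarrow> (nat \<Rightarrow> 'h \<Rightarrow> 'h) \<Rightarrow> bool"
  where "dual_ops s ip I V W Q \<longleftrightarrow>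
    (\<forall>i\<in>I. bounded_op s (Q i) \<and> ortho ip (W i) \<subseteq> {x. Q i x = 0} \<and> range (Q i) \<subseteq> V i \<and>
           (i \<notin> zero_indices I V W \<longrightarrow> onorm (Q i) = 1))"

text \<open>\<open>ff_dual s ip I V d W c\<close>: the sequence \<open>(V, d)\<close> is a fusion frame dual of \<open>(W, c)\<close>.\<close>

definition ff_dual ::
    "('k::rc_field \<Rightarrow> 'h::{real_inner,banach} \<Rightarrow> 'h) \<Rightarrow> ('h \<Rightarrow> 'h \<Rightarrow> 'k) \<Rightarrow> nat set \<Rightarrow>
      (nat \<Rightarrow> 'h set) \<Rightarrow> (nat \<Rightarrow> real) \<Rightarrow> (nat \<Rightarrow> 'h set) \<Rightarrow> (nat \<Rightarrow> real) \<Rightarrow> bool"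
  where "ff_dual s ip I V d W c \<longleftrightarrow>
    bessel_fusion_seq s ip I V d \<and> fusion_frame s ip I W c \<and>
    (\<exists>Q. dual_ops s ip I V W Q \<and>
         (\<forall>x. ((\<lambda>i. (c i * d i) *\<^sub>R Q i x) has_sum x) I))"

end

theory Submission
  imports Defs
begin

text \<open>
  Since \<open>Q\<^sub>i\<close> vanishes on the orthogonal complement of \<open>W\<^sub>i\<close>, the dual operators \<open>d\<^sub>i Q\<^sub>i\<^sup>*\<close> reproduce
  \<open>x\<close> exactly when the fusion frame dual does, and they form a Bessel sequence because
  \<open>Q\<^sub>i\<^sup>* = Q\<^sub>i\<^sup>* P\<close> with \<open>P\<close> the projection onto \<open>V\<^sub>i\<close> and \<open>\<parallel>Q\<^sub>i\<parallel> \<le> 1\<close>. The operators \<open>Q\<^sub>i\<close> and \<open>L\<^sub>i\<close>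
  determine each other through \<open>A\<^sub>i = d\<^sub>i Q\<^sub>i\<close>: one takes \<open>L\<^sub>i = d\<^sub>i Q\<^sub>i\<^sup>* - c\<^sub>i P S\<^sup>-\<^sup>1\<close>, now with \<open>P\<close> the
  projection onto \<open>W\<^sub>i\<close>, and conversely \<open>Q\<^sub>i = A\<^sub>i / d\<^sub>i\<close>. In both directions
  \<open>\<Sum> c\<^sub>i A\<^sub>i x = S\<^sup>-\<^sup>1 S x + T\<^sub>L\<^sup>* T\<^sub>W x\<close>, so the reproducing formula is the condition
  \<open>T\<^sub>L\<^sup>* T\<^sub>W = 0\<close>. The Hilbert space background (orthogonal projections, Riesz representation and
  adjoints) comes from minimising \<open>\<parallel>y\<parallel>\<^sup>2 - 2 \<phi> y\<close> over a closed subspace.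
\<close>

section \<open>Real Hilbert spaces\<close>

text \<open>One statement with three uses: for \<open>\<phi> v = inner v x\<close> the vector is the
  projection of x onto V, for V the whole space this is the Riesz theorem, and for V the closed
  range of the frame operator it leads to surjectivity. Only the real inner product enters, so both
  scalar fields are covered.\<close>

lemma riesz_representation_on_subspace:
  fixes \<phi> :: "'a::{real_inner,banach} \<Rightarrow> real"
  assumes \<phi>: "bounded_linear \<phi>" and V: "subspace V" and "closed V"
  shows "\<exists>y\<in>V. \<forall>v\<in>V. inner v y = \<phi> v"
proof -
  interpret \<phi>: bounded_linear \<phi> by (rule \<phi>)
  \<comment> \<open>The representing vector is the minimiser of this functional on \<open>V\<close>.\<close>
  define J where "J y = (norm y)\<^sup>2 - 2 * \<phi> y" for y
  obtain K where K: "\<And>x. norm (\<phi> x) \<le> norm x * K"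
    using \<phi>.bounded by blast
  \<comment> \<open>Completing the square: \<open>J y\<close> is at least
    \<open>(norm y - K)\<^sup>2 - K\<^sup>2\<close>.\<close>
  have lower: "- K\<^sup>2 \<le> J y" for y
  proof -
    have "\<phi> y \<le> norm y * K" using K[of y] by auto
    moreover have "0 \<le> (norm y - K)\<^sup>2" by simp
    ultimately show ?thesis by (simp add: J_def power2_diff)
  qed
  define m where "m = (INF y\<in>V. J y)"
  have bdd: "bdd_below (J ` V)" using lower by (intro bdd_belowI2)
  have "V \<noteq> {}" using V by (auto simp: subspace_def)
  have m_le: "m \<le> J y" if "y \<in> V" for y
    unfolding m_def using bdd that by (rule cINF_lower)
  have "\<exists>y\<in>V. J y < m + 1 / real (Suc n)" for n
    using cINF_less_iff[OF \<open>V \<noteq> {}\<close> bdd, of "m + 1 / real (Suc n)"]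
    by (simp add: m_def)
  then obtain y where yV: "\<And>n. y n \<in> V" and y: "\<And>n. J (y n) < m + 1 / real (Suc n)"
    by metis
  \<comment> \<open>The parallelogram law; the contributions of \<open>\<phi>\<close> cancel by
    linearity, so near-minimisers are close to each other.\<close>
  have parallelogram: "(norm (u - v))\<^sup>2 = 2 * J u + 2 * J v - 4 * J ((1/2) *\<^sub>R (u + v))" for u v
    by (simp add: J_def \<phi>.scaleR \<phi>.add power2_norm_eq_inner algebra_simps inner_commute)
  have close: "(norm (y i - y j))\<^sup>2 < 4 / real (Suc N)" if "N \<le> i" "N \<le> j" for i j N
  proof -
    have "(1/2) *\<^sub>R (y i + y j) \<in> V" using V yV by (auto simp: subspace_def)
    then have "(norm (y i - y j))\<^sup>2 < 2 / real (Suc i) + 2 / real (Suc j)"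
      using parallelogram[of "y i" "y j"] m_le y[of i] y[of j] by fastforce
    also have "\<dots> \<le> 2 / real (Suc N) + 2 / real (Suc N)"
      using that by (intro add_mono divide_left_mono) auto
    finally show ?thesis by simp
  qed
  have "Cauchy y"
  proof (rule metric_CauchyI)
    fix e :: real assume "0 < e"
    then obtain N where N: "4 / e\<^sup>2 < real N" using reals_Archimedean2 by blast
    then have "4 < real N * e\<^sup>2" using \<open>0 < e\<close> by (simp add: pos_divide_less_eq)
    also have "\<dots> \<le> e\<^sup>2 * real (Suc N)" by (simp add: algebra_simps)
    finally have "4 / real (Suc N) < e\<^sup>2" by (simp add: pos_divide_less_eq)
    then have "dist (y i) (y j) < e" if "N \<le> i" "N \<le> j" for i j
      using close[OF that] \<open>0 < e\<close> power2_less_imp_less[of "norm (y i - y j)" e]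
      by (simp add: dist_norm)
    then show "\<exists>M. \<forall>i\<ge>M. \<forall>j\<ge>M. dist (y i) (y j) < e" by blast
  qed
  then obtain z where z: "y \<longlonglongrightarrow> z" using Cauchy_convergent convergent_def by blast
  have zV: "z \<in> V" using \<open>closed V\<close> yV z by (rule closed_sequentially)
  have "(\<lambda>n. J (y n)) \<longlonglongrightarrow> J z"
    unfolding J_def by (intro tendsto_intros z \<phi>.tendsto)
  moreover have "(\<lambda>n. m + 1 / real (Suc n)) \<longlonglongrightarrow> m + 0"
    by (intro tendsto_intros LIMSEQ_Suc[OF lim_1_over_n])
  ultimately have "J z \<le> m + 0" by (rule LIMSEQ_le) (use y in \<open>auto intro: less_imp_le\<close>)
  then have min: "J z \<le> J u" if "u \<in> V" for u using m_le[OF that] by simp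
  have "inner v z = \<phi> v" if "v \<in> V" for v
  proof (rule ccontr)
    assume "inner v z \<noteq> \<phi> v"
    define b where "b = inner v z - \<phi> v"
    have "b \<noteq> 0" using \<open>inner v z \<noteq> \<phi> v\<close> by (simp add: b_def)
    \<comment> \<open>The choice \<open>t = - b / a\<close> minimises
      \<open>t\<^sup>2 * a + 2 * t * b\<close>, with minimum \<open>- (b\<^sup>2 / a)\<close>. The
      extra 1 keeps \<open>a\<close> positive when \<open>v = 0\<close>.\<close>
    define a where "a = (norm v)\<^sup>2 + 1"
    have "a > 0" by (simp add: a_def add_nonneg_pos)
    define t where "t = - b / a"
    have "z + t *\<^sub>R v \<in> V" using V zV that by (auto simp: subspace_def)
    then have "J z \<le> J (z + t *\<^sub>R v)" by (rule min)
    moreover have "(norm (z + t *\<^sub>R v))\<^sup>2 = (norm z)\<^sup>2 + 2 * t * inner v z + t\<^sup>2 * (norm v)\<^sup>2"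
      by (simp add: power2_norm_eq_inner power2_eq_square[of t] algebra_simps inner_commute)
    ultimately have "0 \<le> t\<^sup>2 * (norm v)\<^sup>2 + 2 * t * b"
      by (simp add: J_def b_def \<phi>.scaleR \<phi>.add algebra_simps)
    also have "\<dots> \<le> t\<^sup>2 * a + 2 * t * b" by (simp add: a_def algebra_simps)
    also have "\<dots> = - (b\<^sup>2 / a)"
      using \<open>a > 0\<close> by (simp add: t_def field_simps power2_eq_square)
    also have "\<dots> < 0" using \<open>a > 0\<close> \<open>b \<noteq> 0\<close> by simp
    finally show False by simp
  qed
  then show ?thesis using zV by blast
qed

text \<open>The Cauchy criterion along finite subsets: for nested sets the difference of two partial
  sums of \<open>g\<close> is a sum over \<open>U - F\<close>, which is controlled by the difference
  of the partial sums of \<open>a\<close>. Absolute convergence is not claimed; synthesis series may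
  lack it.\<close>

lemma summable_on_if_norm_sum_le:
  fixes g :: "'i \<Rightarrow> 'a::banach" and a :: "'i \<Rightarrow> real"
  assumes a: "a summable_on A" and "0 \<le> \<beta>"
    and le: "\<And>F. finite F \<Longrightarrow> F \<subseteq> A \<Longrightarrow> (norm (sum g F))\<^sup>2 \<le> \<beta> * sum a F"
  shows "g summable_on A"
proof -
  obtain L where L: "(sum a \<longlongrightarrow> L) (finite_subsets_at_top A)"
    using a unfolding summable_on_def has_sum_def by blast
  have "\<exists>P. eventually P (finite_subsets_at_top A) \<and>
          (\<forall>F F'. P F \<and> P F' \<longrightarrow> dist (sum g F) (sum g F') < e)" if "e > 0" for e
  proof -
    \<comment> \<open>Chosen so that
      \<open>(\<beta> + 1) * (2 * \<delta>) = (e / 2)\<^sup>2\<close>; the 1 avoids division by zero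
      when \<open>\<beta> = 0\<close>.\<close>
    define \<delta> where "\<delta> = e\<^sup>2 / (8 * (\<beta> + 1))"
    have "\<delta> > 0" using that \<open>0 \<le> \<beta>\<close> by (simp add: \<delta>_def)
    then have "eventually (\<lambda>F. dist (sum a F) L < \<delta>) (finite_subsets_at_top A)"
      using L by (auto simp: tendsto_iff)
    then obtain F0 where F0: "finite F0" "F0 \<subseteq> A"
      and a_close: "\<And>F. finite F \<Longrightarrow> F0 \<subseteq> F \<Longrightarrow> F \<subseteq> A \<Longrightarrow> dist (sum a F) L < \<delta>"
      by (auto simp: eventually_finite_subsets_at_top)
    define P where "P F \<longleftrightarrow> finite F \<and> F0 \<subseteq> F \<and> F \<subseteq> A" for F
    have "eventually P (finite_subsets_at_top A)"
      unfolding eventually_finite_subsets_at_top P_def using F0 by blast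
    moreover have half: "dist (sum g U) (sum g F) < e / 2" if "P F" "P U" "F \<subseteq> U" for F U
    proof -
      have fin: "finite U" "finite F" using that by (auto simp: P_def)
      have "(dist (sum g U) (sum g F))\<^sup>2 = (norm (sum g (U - F)))\<^sup>2"
        using fin that by (simp add: dist_norm sum_diff)
      also have "\<dots> \<le> \<beta> * sum a (U - F)" using that by (intro le) (auto simp: P_def)
      also have "sum a (U - F) = sum a U - sum a F" using fin that by (simp add: sum_diff)
      also have "\<beta> * (sum a U - sum a F) \<le> \<beta> * (2 * \<delta>)"
        using a_close[of U] a_close[of F] that \<open>0 \<le> \<beta>\<close>
        by (intro mult_left_mono) (auto simp: P_def dist_real_def)
      also have "\<dots> < (\<beta> + 1) * (2 * \<delta>)" using \<open>\<delta> > 0\<close> by (simp add: algebra_simps)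
      also have "\<dots> = (e / 2)\<^sup>2" using \<open>0 \<le> \<beta>\<close> by (simp add: \<delta>_def field_simps)
      finally show ?thesis
        using \<open>e > 0\<close> power2_less_imp_less[of "dist (sum g U) (sum g F)" "e / 2"] by simp
    qed
    \<comment> \<open>Sets that are not nested are compared through their union.\<close>
    moreover have "dist (sum g F) (sum g F') < e" if "P F" "P F'" for F F'
    proof -
      have "P (F \<union> F')" using that by (auto simp: P_def)
      then show ?thesis
        using half[of F "F \<union> F'"] half[of F' "F \<union> F'"] that
          dist_triangle_half_r[of "sum g (F \<union> F')" "sum g F" e "sum g F'"] by simp
    qed
    ultimately show ?thesis by blast
  qed
  then have "cauchy_filter (filtermap (sum g) (finite_subsets_at_top A))"
    by (simp add: cauchy_filter_metric_filtermap)
  moreover have "complete (UNIV :: 'a set)"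
    by (meson Cauchy_convergent UNIV_I complete_def convergent_def)
  ultimately obtain l where "(sum g \<longlongrightarrow> l) (finite_subsets_at_top A)"
    using complete_uniform[where S=UNIV] by (force simp add: filterlim_def)
  then show ?thesis unfolding summable_on_def has_sum_def by blast
qed

section \<open>The scalar field\<close>

text \<open>By \<open>add_conjg\<close>, \<open>x + conjg x\<close> is a real multiple of 1, which
  conjugation fixes; additivity then lets \<open>conjg x\<close> cancel.\<close>

lemma conjg_conjg [simp]: "conjg (conjg x) = (x :: 'k::rc_field)"
proof -
  have "conjg (x + conjg x) = x + conjg x" by (simp only: add_conjg conjg_scaleR_one)
  then show ?thesis by (simp add: conjg_add add.commute)
qed

lemma conjg_zero [simp]: "conjg 0 = (0 :: 'k::rc_field)"
  using conjg_scaleR_one[of 0, where 'a='k] by simp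

lemma norm_conjg [simp]: "norm (conjg x) = norm (x :: 'k::rc_field)"
proof (cases "x = 0")
  case False
  have "norm (x * conjg x) = (norm x)\<^sup>2" by (simp add: mult_conjg)
  then show ?thesis using False by (simp add: norm_mult power2_eq_square)
qed simp

lemma conjg_scaleR: "conjg (r *\<^sub>R x) = r *\<^sub>R conjg (x :: 'k::rc_field)"
  using conjg_mult[of "r *\<^sub>R 1" x] by (simp add: conjg_scaleR_one)

lemma re_part_eq_iff: "re_part (x :: 'k::rc_field) = r \<longleftrightarrow> x + conjg x = (2 * r) *\<^sub>R 1"
  by (auto simp: add_conjg)

lemma re_part_add: "re_part (x + y :: 'k::rc_field) = re_part x + re_part y"
proof -
  have "(x + y) + conjg (x + y) = (x + conjg x) + (y + conjg y)"
    by (simp add: conjg_add algebra_simps)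
  also have "\<dots> = (2 * (re_part x + re_part y)) *\<^sub>R 1"
    by (simp add: add_conjg algebra_simps)
  finally show ?thesis by (simp only: re_part_eq_iff)
qed

lemma re_part_scaleR_one [simp]: "re_part (r *\<^sub>R (1 :: 'k::rc_field)) = r"
  by (simp only: re_part_eq_iff conjg_scaleR_one scaleR_add_left [symmetric]) simp

lemma re_part_zero [simp]: "re_part (0 :: 'k::rc_field) = 0"
  using re_part_scaleR_one[of 0, where 'k='k] by simp

lemma re_part_scaleR: "re_part (r *\<^sub>R x) = r * re_part (x :: 'k::rc_field)"
proof -
  have "r *\<^sub>R x + conjg (r *\<^sub>R x) = r *\<^sub>R (x + conjg x)"
    by (simp add: conjg_scaleR scaleR_add_right)
  also have "\<dots> = (2 * (r * re_part x)) *\<^sub>R 1" by (simp add: add_conjg)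
  finally show ?thesis by (simp only: re_part_eq_iff)
qed

lemma abs_re_part_le: "\<bar>re_part x\<bar> \<le> norm (x :: 'k::rc_field)"
proof -
  have "2 * \<bar>re_part x\<bar> = norm (x + conjg x)" by (simp add: add_conjg abs_mult)
  also have "\<dots> \<le> 2 * norm x" using norm_triangle_ineq[of x "conjg x"] by simp
  finally show ?thesis by simp
qed

text \<open>Taking \<open>a\<close> to be the conjugate of \<open>x - y\<close> gives
  \<open>norm (x - y) = 0\<close>. This lifts statements about the real inner product to
  \<open>ip\<close>.\<close>

lemma eq_if_re_part_mult_eq:
  fixes x y :: "'k::rc_field"
  assumes "\<And>a. re_part (a * x) = re_part (a * y)"
  shows "x = y"
proof -
  define z where "z = x - y"
  have "re_part (conjg z * z) = 0"
    using assms[of "conjg z"] re_part_add[of "conjg z * z" "conjg z * y"]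
    by (simp add: z_def right_diff_distrib)
  then have "re_part (z * conjg z) = 0" by (simp add: mult.commute)
  then have "norm z = 0" by (simp add: mult_conjg)
  then show ?thesis by (simp add: z_def)
qed

lemma bounded_linear_re_part: "bounded_linear (re_part :: 'k::rc_field \<Rightarrow> real)"
  by (rule bounded_linear_intro[where K=1])
    (auto simp: re_part_add re_part_scaleR abs_re_part_le)

section \<open>Operators on a Hilbert space\<close>

context hilbert_space
begin

section \<open>Sesquilinearity of the inner product and the Cauchy-Schwarz inequality\<close>

lemma ip_add_right: "ip z (x + y) = ip z x + ip z y"
  by (metis ip_commute ip_add_left conjg_add)

lemma ip_scale_right: "ip y (scale a x) = conjg a * ip y x"
  by (metis ip_commute ip_scale_left conjg_mult)

lemma ip_scaleR_left: "ip (r *\<^sub>R x) y = r *\<^sub>R ip x y"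
  using ip_scale_left[of "of_real r" x y] by (simp add: scale_of_real scaleR_conv_of_real)

lemma ip_scaleR_right: "ip y (r *\<^sub>R x) = r *\<^sub>R ip y x"
  by (metis ip_commute ip_scaleR_left conjg_scaleR)

lemma ip_zero_left [simp]: "ip 0 y = 0" and ip_zero_right [simp]: "ip y 0 = 0"
  using ip_scaleR_left[of 0 0] ip_scaleR_right[of _ 0 0] by simp_all

lemma ip_diff_left: "ip (x - y) z = ip x z - ip y z"
  by (metis ip_add_left diff_add_cancel add_diff_cancel_right')

lemma ip_diff_right: "ip z (x - y) = ip z x - ip z y"
  by (metis ip_add_right diff_add_cancel add_diff_cancel_right')

lemma scale_scaleR: "scale a (r *\<^sub>R x) = r *\<^sub>R scale a x"
  by (metis scale_of_real scale_scale mult.commute)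

lemma norm_scale: "norm (scale a x) = norm a * norm x"
proof -
  have "ip (scale a x) (scale a x) = (a * conjg a) * ip x x"
    by (simp add: ip_scale_left ip_scale_right mult_ac)
  then have "(norm (scale a x))\<^sup>2 = (norm a * norm x)\<^sup>2"
    by (simp add: power2_norm_eq_inner inner_re_part mult_conjg re_part_scaleR power_mult_distrib)
  then show ?thesis by (simp add: power2_eq_iff_nonneg)
qed

text \<open>The real Cauchy-Schwarz inequality suffices after multiplying \<open>x\<close> by
  \<open>conjg (ip x y)\<close>, which makes the inner product with \<open>y\<close> real.\<close>

lemma norm_ip_le: "norm (ip x y) \<le> norm x * norm y"
proof -
  define a where "a = conjg (ip x y)"
  have "ip (scale a x) y = (norm (ip x y))\<^sup>2 *\<^sub>R 1"
    by (simp add: ip_scale_left a_def mult.commute[of "conjg _"] mult_conjg)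
  then have "(norm (ip x y))\<^sup>2 = inner (scale a x) y" by (simp add: inner_re_part)
  also have "\<dots> \<le> norm (scale a x) * norm y" by (rule norm_cauchy_schwarz)
  also have "\<dots> = norm (ip x y) * (norm x * norm y)" by (simp add: norm_scale a_def)
  finally show ?thesis
    by (cases "ip x y = 0") (simp_all add: power2_eq_square)
qed

lemma bounded_linear_ip_right: "bounded_linear (ip x)"
  by (rule bounded_linear_intro[where K="norm x"])
    (auto simp: ip_add_right ip_scaleR_right norm_ip_le mult.commute[of _ "norm x"])

lemma bounded_linear_ip_left: "bounded_linear (\<lambda>x. ip x y)"
  by (rule bounded_linear_intro[where K="norm y"])
    (auto simp: ip_add_left ip_scaleR_left norm_ip_le)

lemma ip_eqI:
  assumes "\<And>x. ip x y = ip x z"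
  shows "y = z"
proof -
  have "inner (y - z) (y - z) = 0"
    using assms[of "y - z"] inner_re_part[of "y - z" y] inner_re_part[of "y - z" z]
    by (simp add: inner_diff_right)
  then show ?thesis by simp
qed

lemma ip_eqI_left:
  assumes "\<And>x. ip y x = ip z x"
  shows "y = z"
  by (rule ip_eqI) (metis assms ip_commute)

section \<open>Closure properties of bounded operators\<close>

lemma bounded_opI:
  assumes "\<And>x y. A (x + y) = A x + A y" "\<And>a x. A (scale a x) = scale a (A x)"
    and "\<And>x. norm (A x) \<le> norm x * K"
  shows "bounded_op scale A"
proof -
  have "A (r *\<^sub>R x) = r *\<^sub>R A x" for r x
    using assms(2)[of "of_real r" x] by (simp add: scale_of_real)
  then have "bounded_linear A" using assms by (intro bounded_linear_intro)
  moreover have "Vector_Spaces.linear scale scale A" using assms by unfold_locales auto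
  ultimately show ?thesis by (simp add: bounded_op_def)
qed

lemma bounded_opD:
  assumes "bounded_op scale A"
  shows "bounded_linear A" "A (x + y) = A x + A y" "A (scale a x) = scale a (A x)"
    "norm (A x) \<le> norm x * onorm A"
proof -
  show "bounded_linear A" using assms by (simp add: bounded_op_def)
  then show "A (x + y) = A x + A y" "norm (A x) \<le> norm x * onorm A"
    by (auto simp: linear_simps onorm mult.commute)
  interpret Vector_Spaces.linear scale scale A using assms by (simp add: bounded_op_def)
  show "A (scale a x) = scale a (A x)" by (rule scale)
qed

lemma bounded_op_add:
  assumes "bounded_op scale A" "bounded_op scale B"
  shows "bounded_op scale (\<lambda>x. A x + B x)"
proof (rule bounded_opI)
  show "norm (A x + B x) \<le> norm x * (onorm A + onorm B)" for x
    using norm_triangle_ineq[of "A x" "B x"] bounded_opD(4)[OF assms(1), of x]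
      bounded_opD(4)[OF assms(2), of x] by (simp add: distrib_left)
qed (simp_all add: assms[THEN bounded_opD(2)] assms[THEN bounded_opD(3)] scale_right_distrib)

lemma bounded_op_scaleR:
  assumes "bounded_op scale A"
  shows "bounded_op scale (\<lambda>x. r *\<^sub>R A x)"
proof (rule bounded_opI)
  show "norm (r *\<^sub>R A x) \<le> norm x * (\<bar>r\<bar> * onorm A)" for x
    using mult_left_mono[OF bounded_opD(4)[OF assms, of x] abs_ge_zero[of r]]
    by (simp add: mult_ac)
qed (simp_all add: bounded_opD[OF assms] scaleR_add_right scale_scaleR)

lemma bounded_op_diff:
  assumes "bounded_op scale A" "bounded_op scale B"
  shows "bounded_op scale (\<lambda>x. A x - B x)"
  using bounded_op_add[OF assms(1) bounded_op_scaleR[OF assms(2), of "-1"]] by simp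

lemma bounded_op_compose:
  assumes "bounded_op scale A" "bounded_op scale B"
  shows "bounded_op scale (\<lambda>x. A (B x))"
proof (rule bounded_opI)
  show "norm (A (B x)) \<le> norm x * (onorm B * onorm A)" for x
  proof -
    have "norm (A (B x)) \<le> norm (B x) * onorm A" by (rule bounded_opD(4)[OF assms(1)])
    also have "\<dots> \<le> (norm x * onorm B) * onorm A"
      by (intro mult_right_mono bounded_opD(4)[OF assms(2)] onorm_pos_le bounded_opD(1)[OF assms(1)])
    finally show ?thesis by (simp add: mult.assoc)
  qed
qed (simp_all add: assms[THEN bounded_opD(2)] assms[THEN bounded_opD(3)])

subsection \<open>Adjoints\<close>

text \<open>A linear functional is determined by the values of its real part at all scalar multiples
  of x, so the vector representing the real part also represents \<open>\<phi>\<close>.\<close>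

lemma riesz_representation:
  assumes add: "\<And>x y. \<phi> (x + y) = \<phi> x + \<phi> y"
    and sc: "\<And>a x. \<phi> (scale a x) = a * \<phi> x"
    and bound: "\<And>x. norm (\<phi> x) \<le> norm x * K"
  shows "\<exists>y. \<forall>x. \<phi> x = ip x y"
proof -
  have "bounded_linear \<phi>"
    using sc[of "of_real _"]
    by (intro bounded_linear_intro[where K=K] add bound)
      (simp add: scale_of_real scaleR_conv_of_real)
  then have "bounded_linear (\<lambda>x. re_part (\<phi> x))"
    using bounded_linear_compose[OF bounded_linear_re_part] by blast
  then obtain y where y: "\<And>x. inner x y = re_part (\<phi> x)"
    using riesz_representation_on_subspace[of "\<lambda>x. re_part (\<phi> x)" UNIV]
    by (auto simp: real_vector.subspace_UNIV)
  have "\<phi> x = ip x y" for x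
  proof (rule eq_if_re_part_mult_eq)
    fix a
    show "re_part (a * \<phi> x) = re_part (a * ip x y)"
      using y[of "scale a x"] by (simp add: inner_re_part sc ip_scale_left)
  qed
  then show ?thesis by blast
qed

lemma adj_eqI:
  assumes "\<And>x. ip (A x) y = ip x z"
  shows "adj ip A y = z"
  unfolding adj_def using assms by (intro the_equality) (auto intro: ip_eqI)

lemma ip_adj:
  assumes "bounded_op scale A"
  shows "ip (A x) y = ip x (adj ip A y)"
proof -
  have "\<exists>z. \<forall>x. ip (A x) y = ip x z"
  proof (rule riesz_representation)
    show "norm (ip (A x) y) \<le> norm x * (onorm A * norm y)" for x
    proof -
      have "norm (ip (A x) y) \<le> norm (A x) * norm y" by (rule norm_ip_le)
      also have "\<dots> \<le> (norm x * onorm A) * norm y"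
        by (intro mult_right_mono bounded_opD(4)[OF assms]) simp
      finally show ?thesis by (simp add: mult.assoc)
    qed
  qed (simp_all add: bounded_opD[OF assms] ip_add_left ip_scale_left)
  then obtain z where z: "\<And>x. ip (A x) y = ip x z" by blast
  then show ?thesis using adj_eqI[of A y z] by simp
qed

lemma ip_adj_left:
  assumes "bounded_op scale A"
  shows "ip (adj ip A x) y = ip x (A y)"
  by (metis ip_adj[OF assms] ip_commute)

lemma inner_adj:
  assumes "bounded_op scale A"
  shows "inner (A x) y = inner x (adj ip A y)"
  by (simp add: inner_re_part ip_adj[OF assms])

lemma norm_adj_le:
  assumes "bounded_op scale A"
  shows "norm (adj ip A y) \<le> norm y * onorm A"
proof -
  have "(norm (adj ip A y))\<^sup>2 = inner (A (adj ip A y)) y"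
    by (simp add: inner_adj[OF assms] power2_norm_eq_inner)
  also have "\<dots> \<le> norm (A (adj ip A y)) * norm y" by (rule norm_cauchy_schwarz)
  also have "\<dots> \<le> (norm (adj ip A y) * onorm A) * norm y"
    by (intro mult_right_mono bounded_opD(4)[OF assms]) simp
  finally show ?thesis
    by (cases "adj ip A y = 0")
      (auto simp: power2_eq_square mult_ac onorm_pos_le bounded_opD(1)[OF assms])
qed

lemma bounded_op_adj:
  assumes "bounded_op scale A"
  shows "bounded_op scale (adj ip A)"
proof (rule bounded_opI)
  show "norm (adj ip A y) \<le> norm y * onorm A" for y by (rule norm_adj_le[OF assms])
qed (rule ip_eqI_left, simp add: ip_adj_left[OF assms] ip_add_left ip_scale_left)+

lemma adj_scaleR_adj:
  assumes "bounded_op scale A"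
  shows "adj ip (\<lambda>x. r *\<^sub>R adj ip A x) y = r *\<^sub>R A y"
  by (rule adj_eqI) (simp add: ip_scaleR_left ip_scaleR_right ip_adj_left[OF assms])

subsection \<open>Orthogonal projections\<close>

text \<open>V contains \<open>scale (conjg a) v\<close> along with \<open>v\<close>, so real
  orthogonality to V controls the real part of every multiple \<open>a * ip x v\<close>.\<close>

lemma ortho_eq_orthogonal:
  assumes "subspace V"
  shows "x \<in> ortho ip V \<longleftrightarrow> (\<forall>v\<in>V. inner x v = 0)"
proof
  assume "x \<in> ortho ip V"
  then show "\<forall>v\<in>V. inner x v = 0"
    by (simp add: ortho_def inner_re_part)
next
  assume x: "\<forall>v\<in>V. inner x v = 0"
  have "ip x v = 0" if "v \<in> V" for v
  proof (rule eq_if_re_part_mult_eq)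
    fix a
    have "scale (conjg a) v \<in> V" using assms that by (rule subspace_scale)
    then have "re_part (ip x (scale (conjg a) v)) = 0" using x by (simp add: inner_re_part)
    then show "re_part (a * ip x v) = re_part (a * 0)"
      by (simp add: ip_scale_right)
  qed
  then show "x \<in> ortho ip V" by (simp add: ortho_def)
qed

lemma real_subspace:
  assumes "subspace V"
  shows "real_vector.subspace V"
  using assms subspace_scale[OF assms, of _ "of_real _"]
  by (auto simp: real_vector.subspace_def subspace_0 subspace_add scale_of_real)

context
  fixes V
  assumes V: "closed_subspace scale V"
begin

lemma proj_eqI:
  assumes "y \<in> V" "x - y \<in> ortho ip V"
  shows "proj ip V x = y"
  unfolding proj_def
proof (rule the_equality)
  fix z assume z: "z \<in> V \<and> x - z \<in> ortho ip V"
  have "z - y \<in> V" using V z assms by (auto simp: closed_subspace_def intro: subspace_diff)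
  moreover have "z - y \<in> ortho ip V"
    using z assms by (auto simp: ortho_def ip_diff_left)
  ultimately have "inner (z - y) (z - y) = 0"
    using V ortho_eq_orthogonal[of V "z - y"] by (auto simp: closed_subspace_def)
  then show "z = y" by simp
qed (use assms in blast)

lemma proj_mem: "proj ip V x \<in> V"
  and diff_proj_ortho: "x - proj ip V x \<in> ortho ip V"
proof -
  have sub: "subspace V" "closed V" using V by (auto simp: closed_subspace_def)
  \<comment> \<open>The projection of x is the vector of V that represents
    \<open>\<lambda>v. inner v x\<close> on V.\<close>
  obtain y where y: "y \<in> V" "\<forall>v\<in>V. inner v y = inner v x"
    using riesz_representation_on_subspace[OF bounded_linear_inner_left[of x]
        real_subspace[OF sub(1)] sub(2)] by blast
  then have "x - y \<in> ortho ip V"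
    unfolding ortho_eq_orthogonal[OF sub(1)] 
    by (simp add: inner_diff_right inner_commute[of "x - y"])
  then show "proj ip V x \<in> V" "x - proj ip V x \<in> ortho ip V"
    using proj_eqI[OF y(1)] y(1) by auto
qed

lemma ip_proj_right:
  assumes "v \<in> V"
  shows "ip v (proj ip V x) = ip v x"
proof -
  have "ip (x - proj ip V x) v = 0" using diff_proj_ortho assms by (auto simp: ortho_def)
  then have "ip v (x - proj ip V x) = 0" by (metis ip_commute conjg_zero)
  then show ?thesis by (simp add: ip_diff_right)
qed

text \<open>Both sides equal \<open>ip (proj ip V x) (proj ip V y)\<close>.\<close>

lemma ip_proj: "ip (proj ip V x) y = ip x (proj ip V y)"
  by (metis ip_proj_right[OF proj_mem] ip_commute)

lemma proj_id: "v \<in> V \<Longrightarrow> proj ip V v = v"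
  by (rule proj_eqI) (auto simp: ortho_def)

lemma norm_proj_le: "norm (proj ip V x) \<le> norm x"
proof -
  have "(norm (proj ip V x))\<^sup>2 = inner (proj ip V x) x"
    by (simp add: power2_norm_eq_inner inner_re_part ip_proj_right[OF proj_mem])
  also have "\<dots> \<le> norm (proj ip V x) * norm x" by (rule norm_cauchy_schwarz)
  finally show ?thesis
    by (cases "proj ip V x = 0") (auto simp: power2_eq_square)
qed

lemma bounded_op_proj: "bounded_op scale (proj ip V)"
proof (rule bounded_opI)
  show "norm (proj ip V x) \<le> norm x * 1" for x using norm_proj_le by simp
qed (rule ip_eqI_left, simp add: ip_proj ip_add_left ip_scale_left)+

end

lemma adj_scaleR_proj:
  assumes "closed_subspace scale V"
  shows "adj ip (\<lambda>x. r *\<^sub>R proj ip V x) y = r *\<^sub>R proj ip V y"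
  by (rule adj_eqI) (simp add: ip_scaleR_left ip_scaleR_right ip_proj[OF assms])

section \<open>Bessel sequences\<close>

lemma op_besselI:
  assumes "\<And>i. i \<in> I \<Longrightarrow> bounded_op scale (A i)"
    and "\<And>x. g x summable_on I" "\<And>x. infsum (g x) I \<le> \<beta> * (norm x)\<^sup>2"
    and "\<And>i x. i \<in> I \<Longrightarrow> (norm (A i x))\<^sup>2 \<le> g x i"
  shows "op_bessel scale I A"
proof -
  have sm: "(\<lambda>i. (norm (A i x))\<^sup>2) summable_on I" for x
    using assms(2)[of x] by (rule summable_on_comparison_test) (use assms(4) in auto)
  \<comment> \<open>\<open>op_bessel\<close> requires a positive constant, but the sign of
    \<open>\<beta>\<close> is not known here.\<close>
  have "(\<Sum>\<^sub>\<infinity>i\<in>I. (norm (A i x))\<^sup>2) \<le> (\<bar>\<beta>\<bar> + 1) * (norm x)\<^sup>2" for x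
  proof -
    have "(\<Sum>\<^sub>\<infinity>i\<in>I. (norm (A i x))\<^sup>2) \<le> infsum (g x) I"
      by (rule infsum_mono) (use sm assms in auto)
    also have "\<dots> \<le> \<beta> * (norm x)\<^sup>2" by (rule assms)
    also have "\<dots> \<le> (\<bar>\<beta>\<bar> + 1) * (norm x)\<^sup>2" by (intro mult_right_mono) auto
    finally show ?thesis .
  qed
  moreover have "\<bar>\<beta>\<bar> + 1 > 0" by simp
  ultimately show ?thesis unfolding op_bessel_def using assms(1) sm by blast
qed

lemma op_bessel_mono:
  assumes B: "op_bessel scale I B"
    and "\<And>i. i \<in> I \<Longrightarrow> bounded_op scale (A i)"
    and "\<And>i x. i \<in> I \<Longrightarrow> norm (A i x) \<le> norm (B i x)"
  shows "op_bessel scale I A"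
proof -
  obtain \<beta> where "\<And>x. (\<lambda>i. (norm (B i x))\<^sup>2) summable_on I"
    "\<And>x. (\<Sum>\<^sub>\<infinity>i\<in>I. (norm (B i x))\<^sup>2) \<le> \<beta> * (norm x)\<^sup>2"
    using B unfolding op_bessel_def by blast
  then show ?thesis
    by (rule op_besselI[rotated]) (use assms in \<open>auto intro: power_mono\<close>)
qed

lemma op_bessel_compose:
  assumes B: "op_bessel scale I B" and R: "bounded_op scale R"
  shows "op_bessel scale I (\<lambda>i x. B i (R x))"
proof -
  obtain \<beta> where \<beta>: "\<beta> > 0" and sm: "\<And>x. (\<lambda>i. (norm (B i x))\<^sup>2) summable_on I"
    and le: "\<And>x. (\<Sum>\<^sub>\<infinity>i\<in>I. (norm (B i x))\<^sup>2) \<le> \<beta> * (norm x)\<^sup>2"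
    using B unfolding op_bessel_def by blast
  have "(\<Sum>\<^sub>\<infinity>i\<in>I. (norm (B i (R x)))\<^sup>2) \<le> (\<beta> * (onorm R)\<^sup>2) * (norm x)\<^sup>2" for x
  proof -
    have "(\<Sum>\<^sub>\<infinity>i\<in>I. (norm (B i (R x)))\<^sup>2) \<le> \<beta> * (norm (R x))\<^sup>2" by (rule le)
    also have "\<dots> \<le> \<beta> * (norm x * onorm R)\<^sup>2"
      using \<beta> by (intro mult_left_mono power_mono bounded_opD(4)[OF R]) auto
    finally show ?thesis by (simp add: power_mult_distrib mult_ac)
  qed
  moreover have "bounded_op scale (\<lambda>x. B i (R x))" if "i \<in> I" for i
    using B R that by (auto simp: op_bessel_def intro: bounded_op_compose)
  ultimately show ?thesis
    by (intro op_besselI[where g="\<lambda>x i. (norm (B i (R x)))\<^sup>2", OF _ sm]) auto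
qed

lemma op_bessel_diff:
  assumes A: "op_bessel scale I A" and B: "op_bessel scale I B"
  shows "op_bessel scale I (\<lambda>i x. A i x - B i x)"
proof -
  obtain \<alpha> where smA: "\<And>x. (\<lambda>i. (norm (A i x))\<^sup>2) summable_on I"
    and leA: "\<And>x. (\<Sum>\<^sub>\<infinity>i\<in>I. (norm (A i x))\<^sup>2) \<le> \<alpha> * (norm x)\<^sup>2"
    using A unfolding op_bessel_def by blast
  obtain \<beta> where smB: "\<And>x. (\<lambda>i. (norm (B i x))\<^sup>2) summable_on I"
    and leB: "\<And>x. (\<Sum>\<^sub>\<infinity>i\<in>I. (norm (B i x))\<^sup>2) \<le> \<beta> * (norm x)\<^sup>2"
    using B unfolding op_bessel_def by blast
  \<comment> \<open>A dominating sequence, because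
    \<open>(a + b)\<^sup>2 \<le> 2 * a\<^sup>2 + 2 * b\<^sup>2\<close>.\<close>
  define g where "g x i = 2 * (norm (A i x))\<^sup>2 + 2 * (norm (B i x))\<^sup>2" for x i
  have sum: "(g x has_sum (2 * (\<Sum>\<^sub>\<infinity>i\<in>I. (norm (A i x))\<^sup>2) + 2 * (\<Sum>\<^sub>\<infinity>i\<in>I. (norm (B i x))\<^sup>2))) I" for x
    unfolding g_def by (intro has_sum_add has_sum_cmult_right has_sum_infsum smA smB)
  show ?thesis
  proof (rule op_besselI)
    show "bounded_op scale (\<lambda>x. A i x - B i x)" if "i \<in> I" for i
      using A B that by (auto simp: op_bessel_def intro: bounded_op_diff)
    show "g x summable_on I" for x using sum by (auto simp: summable_on_def)
    show "infsum (g x) I \<le> (2 * \<alpha> + 2 * \<beta>) * (norm x)\<^sup>2" for x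
      using infsumI[OF sum] leA[of x] leB[of x] by (simp add: algebra_simps)
    show "(norm (A i x - B i x))\<^sup>2 \<le> g x i" for i x
    proof -
      have "(norm (A i x - B i x))\<^sup>2 \<le> (norm (A i x) + norm (B i x))\<^sup>2"
        by (intro power_mono norm_triangle_ineq4) simp
      also have "\<dots> \<le> g x i"
        using zero_le_power2[of "norm (A i x) - norm (B i x)"]
        by (simp add: g_def power2_sum power2_diff)
      finally show ?thesis .
    qed
  qed
qed

text \<open>Synthesis inherits the bound of analysis. Pairing the sum \<open>s\<close> with itself
  moves each adjoint back onto \<open>s\<close>. In the AM-GM inequality with weight
  \<open>\<beta>\<close>, the Bessel bound turns the first half into one copy of
  \<open>(norm s)\<^sup>2\<close>, which is absorbed by the left side
  \<open>2 * (norm s)\<^sup>2\<close>.\<close>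

lemma norm_synthesis_le:
  assumes B: "\<And>i. i \<in> F \<Longrightarrow> bounded_op scale (B i)" and "\<beta> > 0"
    and le: "\<And>x. (\<Sum>i\<in>F. (norm (B i x))\<^sup>2) \<le> \<beta> * (norm x)\<^sup>2"
  shows "(norm (\<Sum>i\<in>F. adj ip (B i) (f i)))\<^sup>2 \<le> \<beta> * (\<Sum>i\<in>F. (norm (f i))\<^sup>2)"
proof -
  define s where "s = (\<Sum>i\<in>F. adj ip (B i) (f i))"
  have am_gm: "2 * inner (B i s) (f i) \<le> (norm (B i s))\<^sup>2 / \<beta> + \<beta> * (norm (f i))\<^sup>2" for i
  proof -
    have "0 \<le> (norm (B i s) - \<beta> * norm (f i))\<^sup>2 / \<beta>" using \<open>\<beta> > 0\<close> by simp
    also have "\<dots> = (norm (B i s))\<^sup>2 / \<beta> - 2 * (norm (B i s) * norm (f i)) + \<beta> * (norm (f i))\<^sup>2"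
      using \<open>\<beta> > 0\<close> by (simp add: field_simps power2_eq_square)
    finally show ?thesis using norm_cauchy_schwarz[of "B i s" "f i"] by linarith
  qed
  have "2 * (norm s)\<^sup>2 = (\<Sum>i\<in>F. 2 * inner (B i s) (f i))"
  proof -
    have "(norm s)\<^sup>2 = (\<Sum>i\<in>F. inner s (adj ip (B i) (f i)))"
      unfolding power2_norm_eq_inner by (subst (2) s_def) (rule inner_sum_right)
    then show ?thesis by (simp add: inner_adj[OF B] sum_distrib_left)
  qed
  also have "\<dots> \<le> (\<Sum>i\<in>F. (norm (B i s))\<^sup>2 / \<beta> + \<beta> * (norm (f i))\<^sup>2)"
    by (intro sum_mono am_gm)
  also have "\<dots> = (\<Sum>i\<in>F. (norm (B i s))\<^sup>2) / \<beta> + \<beta> * (\<Sum>i\<in>F. (norm (f i))\<^sup>2)"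
    by (simp add: sum.distrib sum_divide_distrib sum_distrib_left)
  also have "(\<Sum>i\<in>F. (norm (B i s))\<^sup>2) / \<beta> \<le> (norm s)\<^sup>2"
    using le[of s] \<open>\<beta> > 0\<close> by (simp add: pos_divide_le_eq mult.commute)
  finally show ?thesis by (simp add: s_def)
qed

text \<open>This makes the adjoint, defined through \<open>THE\<close>, computable as a series. The
  bound on finite sums gives convergence, and continuity of \<open>ip x\<close> shows that the sum
  satisfies the adjoint identity.\<close>

lemma synthesis_has_sum:
  assumes B: "op_bessel scale I B" and f: "(\<lambda>i. (norm (f i))\<^sup>2) summable_on I"
  shows "((\<lambda>i. adj ip (B i) (f i)) has_sum l2_adj ip I (analysis_op I B) f) I"
proof -
  obtain \<beta> where \<beta>: "\<beta> > 0" and sm: "\<And>x. (\<lambda>i. (norm (B i x))\<^sup>2) summable_on I"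
    and le: "\<And>x. (\<Sum>\<^sub>\<infinity>i\<in>I. (norm (B i x))\<^sup>2) \<le> \<beta> * (norm x)\<^sup>2"
    using B unfolding op_bessel_def by blast
  have op: "bounded_op scale (B i)" if "i \<in> I" for i using B that by (simp add: op_bessel_def)
  have "(\<lambda>i. adj ip (B i) (f i)) summable_on I"
  proof (rule summable_on_if_norm_sum_le[OF f less_imp_le[OF \<beta>]])
    fix F assume F: "finite F" "F \<subseteq> I"
    show "(norm (\<Sum>i\<in>F. adj ip (B i) (f i)))\<^sup>2 \<le> \<beta> * (\<Sum>i\<in>F. (norm (f i))\<^sup>2)"
    proof (rule norm_synthesis_le)
      show "(\<Sum>i\<in>F. (norm (B i x))\<^sup>2) \<le> \<beta> * (norm x)\<^sup>2" for x
        using finite_sum_le_infsum[OF sm[of x] F] le[of x] by simp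
    qed (use op F \<beta> in auto)
  qed
  then obtain y where y: "((\<lambda>i. adj ip (B i) (f i)) has_sum y) I" by (auto simp: summable_on_def)
  have "l2_ip ip I (analysis_op I B x) f = ip x y" for x
    unfolding l2_ip_def
  proof (rule infsumI)
    have "((\<lambda>i. ip x (adj ip (B i) (f i))) has_sum ip x y) I"
      by (rule has_sum_bounded_linear[OF bounded_linear_ip_right y])
    then show "((\<lambda>i. ip (analysis_op I B x i) (f i)) has_sum ip x y) I"
      by (rule has_sum_cong[THEN iffD1, rotated]) (simp add: analysis_op_def ip_adj[OF op])
  qed
  then have "l2_adj ip I (analysis_op I B) f = y"
    unfolding l2_adj_def by (intro the_equality) (auto intro: ip_eqI)
  then show ?thesis using y by simp
qed

lemma synthesis_analysis_has_sum:
  assumes B: "op_bessel scale I B" and A: "op_bessel scale I A"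
  shows "((\<lambda>i. adj ip (B i) (A i x)) has_sum
           l2_adj ip I (analysis_op I B) (analysis_op I A x)) I"
proof -
  have "(\<lambda>i. (norm (A i x))\<^sup>2) summable_on I" using A unfolding op_bessel_def by blast
  then have "(\<lambda>i. (norm (analysis_op I A x i))\<^sup>2) summable_on I"
    by (rule summable_on_cong[THEN iffD1, rotated]) (simp add: analysis_op_def)
  from synthesis_has_sum[OF B this] show ?thesis
    by (rule has_sum_cong[THEN iffD1, rotated]) (simp add: analysis_op_def)
qed

section \<open>The fusion frame operator\<close>

context
  fixes I W c
  assumes frame: "fusion_frame scale ip I W c"
begin

private abbreviation "S \<equiv> fusion_frame_op ip I W c"

lemma closed_subspace_frame: "i \<in> I \<Longrightarrow> closed_subspace scale (W i)"
  using frame by (simp add: fusion_frame_def fusion_seq_def)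

lemma op_bessel_fusion_ops: "op_bessel scale I (fusion_ops ip W c)"
  using frame by (simp add: fusion_frame_def op_frame_def)

text \<open>With the fusion operators themselves as \<open>L\<close> this yields the frame operator;
  for general \<open>L\<close> it is the cross term that (iii) requires to vanish.\<close>

lemma synthesis_fusion_analysis_has_sum:
  assumes L: "op_bessel scale I L"
  shows "((\<lambda>i. c i *\<^sub>R adj ip (L i) (proj ip (W i) x)) has_sum
           l2_adj ip I (analysis_op I L) (fusion_analysis ip I W c x)) I"
proof -
  have "linear (adj ip (L i))" if "i \<in> I" for i
    using L that by (auto simp: op_bessel_def
        intro!: bounded_linear.linear bounded_opD(1) bounded_op_adj)
  then show ?thesis
    using synthesis_analysis_has_sum[OF L op_bessel_fusion_ops, of x]
    by (subst has_sum_cong) (auto simp: fusion_analysis_def fusion_ops_def linear_cmul)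
qed

text \<open>Each projection is self-adjoint and idempotent, so every term contains it once, with the
  weight squared.\<close>

lemma frame_op_has_sum: "((\<lambda>i. (c i)\<^sup>2 *\<^sub>R proj ip (W i) x) has_sum S x) I"
proof -
  have "((\<lambda>i. c i *\<^sub>R adj ip (fusion_ops ip W c i) (proj ip (W i) x)) has_sum S x) I"
    using synthesis_fusion_analysis_has_sum[OF op_bessel_fusion_ops, of x]
    by (simp add: fusion_frame_op_def fusion_analysis_def)
  then show ?thesis
  proof (rule has_sum_cong[THEN iffD1, rotated])
    fix i assume "i \<in> I"
    then have W: "closed_subspace scale (W i)" by (rule closed_subspace_frame)
    have "fusion_ops ip W c i = (\<lambda>x. c i *\<^sub>R proj ip (W i) x)" by (simp add: fusion_ops_def fun_eq_iff)
    then show "c i *\<^sub>R adj ip (fusion_ops ip W c i) (proj ip (W i) x) = (c i)\<^sup>2 *\<^sub>R proj ip (W i) x"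
      by (simp add: adj_scaleR_proj[OF W] proj_id[OF W proj_mem[OF W]] power2_eq_square)
  qed
qed

lemma ip_frame_op: "ip (S x) y = ip x (S y)"
proof (rule has_sum_unique)
  have "((\<lambda>i. ip ((c i)\<^sup>2 *\<^sub>R proj ip (W i) x) y) has_sum ip (S x) y) I"
    by (rule has_sum_bounded_linear[OF bounded_linear_ip_left frame_op_has_sum])
  then show "((\<lambda>i. ip x ((c i)\<^sup>2 *\<^sub>R proj ip (W i) y)) has_sum ip (S x) y) I"
    by (rule has_sum_cong[THEN iffD1, rotated])
      (simp add: ip_scaleR_left ip_scaleR_right ip_proj[OF closed_subspace_frame])
  show "((\<lambda>i. ip x ((c i)\<^sup>2 *\<^sub>R proj ip (W i) y)) has_sum ip x (S y)) I"
    by (rule has_sum_bounded_linear[OF bounded_linear_ip_right frame_op_has_sum])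
qed

lemma inner_frame_op: "inner x (S x) = (\<Sum>\<^sub>\<infinity>i\<in>I. (norm (fusion_ops ip W c i x))\<^sup>2)"
proof (rule sym, rule infsumI)
  have "((\<lambda>i. inner x ((c i)\<^sup>2 *\<^sub>R proj ip (W i) x)) has_sum inner x (S x)) I"
    by (rule has_sum_bounded_linear[OF bounded_linear_inner_right frame_op_has_sum])
  then show "((\<lambda>i. (norm (fusion_ops ip W c i x))\<^sup>2) has_sum inner x (S x)) I"
  proof (rule has_sum_cong[THEN iffD1, rotated])
    fix i assume "i \<in> I"
    then have W: "closed_subspace scale (W i)" by (rule closed_subspace_frame)
    have "(norm (proj ip (W i) x))\<^sup>2 = inner x (proj ip (W i) x)"
      by (simp add: power2_norm_eq_inner inner_re_part ip_proj[OF W] proj_id[OF W proj_mem[OF W]])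
    then show "inner x ((c i)\<^sup>2 *\<^sub>R proj ip (W i) x) = (norm (fusion_ops ip W c i x))\<^sup>2"
      by (simp add: fusion_ops_def power_mult_distrib)
  qed
qed

text \<open>Linearity follows from symmetry alone:
  \<open>ip (S (x + y)) z = ip (x + y) (S z)\<close>, and the right side is additive in its first
  argument. The inverse is treated the same way.\<close>

lemma frame_op_add: "S (x + y) = S x + S y"
  by (rule ip_eqI_left) (simp add: ip_frame_op ip_add_left)

lemma frame_op_scale: "S (scale a x) = scale a (S x)"
  by (rule ip_eqI_left) (simp add: ip_frame_op ip_scale_left)

lemma bounded_op_frame_op: "bounded_op scale S"
proof -
  obtain \<beta> where \<beta>: "\<beta> > 0"
    and sm: "\<And>x. (\<lambda>i. (norm (fusion_ops ip W c i x))\<^sup>2) summable_on I"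
    and le: "\<And>x. (\<Sum>\<^sub>\<infinity>i\<in>I. (norm (fusion_ops ip W c i x))\<^sup>2) \<le> \<beta> * (norm x)\<^sup>2"
    using op_bessel_fusion_ops unfolding op_bessel_def by blast
  have pos: "0 \<le> inner x (S x)" for x
    unfolding inner_frame_op by (rule infsum_nonneg) simp
  have upper: "inner x (S x) \<le> \<beta> * (norm x)\<^sup>2" for x
    unfolding inner_frame_op by (rule le)
  show ?thesis
  proof (rule bounded_opI)
    fix x
    \<comment> \<open>Positivity of the form at \<open>x - S x / \<beta>\<close> bounds \<open>S x\<close>.\<close>
    define u where "u = (- 1 / \<beta>) *\<^sub>R S x"
    have sym: "inner (S x) v = inner x (S v)" for v by (simp add: inner_re_part ip_frame_op)
    have "0 \<le> inner (x + u) (S (x + u))" by (rule pos)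
    also have "\<dots> = inner x (S x) + 2 * inner u (S x) + inner u (S u)"
      using sym[of u] by (simp add: frame_op_add inner_add_left inner_add_right inner_commute)
    also have "\<dots> \<le> \<beta> * (norm x)\<^sup>2 + 2 * inner u (S x) + \<beta> * (norm u)\<^sup>2"
      using upper[of x] upper[of u] by simp
    also have "inner u (S x) = - (norm (S x))\<^sup>2 / \<beta>" by (simp add: u_def power2_norm_eq_inner)
    also have "(norm u)\<^sup>2 = (norm (S x))\<^sup>2 / \<beta>\<^sup>2"
      by (simp add: u_def power_divide power_mult_distrib)
    \<comment> \<open>The cross term and the last term combine, which leaves \<open>0 \<le> \<beta>
      * (norm x)\<^sup>2 - (norm (S x))\<^sup>2 / \<beta>\<close>.\<close>
    finally have "(norm (S x))\<^sup>2 \<le> (norm x * \<beta>)\<^sup>2"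
      using \<beta> by (simp add: field_simps power2_eq_square)
    then show "norm (S x) \<le> norm x * \<beta>" using \<beta> by (rule_tac power2_le_imp_le) auto
  qed (simp_all add: frame_op_add frame_op_scale)
qed

section \<open>Bounded invertibility of the frame operator\<close>

lemma frame_op_lower_bound: "\<exists>\<alpha>>0. \<forall>x. \<alpha> * norm x \<le> norm (S x)"
proof -
  obtain \<alpha> where \<alpha>: "\<alpha> > 0" "\<And>x. \<alpha> * (norm x)\<^sup>2 \<le> inner x (S x)"
    using frame unfolding fusion_frame_def op_frame_def inner_frame_op by blast
  have "\<alpha> * norm x \<le> norm (S x)" for x
  proof -
    have "norm x * (\<alpha> * norm x) \<le> norm x * norm (S x)"
      using \<alpha>(2)[of x] norm_cauchy_schwarz[of x "S x"] by (simp add: power2_eq_square mult_ac)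
    then show ?thesis by (cases "x = 0") simp_all
  qed
  then show ?thesis using \<alpha>(1) by blast
qed

text \<open>The lower bound makes S injective with complete, hence closed, range. By symmetry a
  vector orthogonal to the range lies in the kernel, which is trivial, so the range is the whole
  space.\<close>

lemma bij_frame_op: "bij S"
proof -
  obtain \<alpha> where \<alpha>: "\<alpha> > 0" "\<And>x. \<alpha> * norm x \<le> norm (S x)" using frame_op_lower_bound by blast
  have lin: "bounded_linear S" using bounded_op_frame_op by (rule bounded_opD)
  have zero: "x = 0" if "S x = 0" for x
    using \<alpha>(1) \<alpha>(2)[of x] that by (simp add: mult_le_0_iff)
  have "inj S"
    using zero linear_injective_0[OF bounded_linear.linear[OF lin]] by blast
  moreover have "surj S"
    unfolding surj_def
  proof
    fix g
    have "complete (range S)"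
      by (rule complete_isometric_image[OF \<alpha>(1) real_vector.subspace_UNIV lin])
        (use \<alpha>(2) complete_UNIV in auto)
    moreover have "real_vector.subspace (range S)"
      using linear_subspace_image[OF bounded_linear.linear[OF lin] real_vector.subspace_UNIV] .
    ultimately obtain y where y: "y \<in> range S" "\<forall>v\<in>range S. inner v y = inner v g"
      using riesz_representation_on_subspace[OF bounded_linear_inner_left[of g]]
        complete_imp_closed by blast
    \<comment> \<open>Here y is the projection of g onto the range, so \<open>g - y\<close> is
      orthogonal to \<open>S (S (g - y))\<close>.\<close>
    have "S (g - y) = 0"
    proof (rule inner_eq_zero_iff[THEN iffD1])
      have "inner (S (g - y)) (S (g - y)) = inner (S (S (g - y))) (g - y)"
        by (simp add: inner_re_part ip_frame_op)
      also have "\<dots> = 0" using y(2) by (simp add: inner_diff_right)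
      finally show "inner (S (g - y)) (S (g - y)) = 0" .
    qed
    then have "g = y" using zero by fastforce
    then show "\<exists>x. g = S x" using y(1) by blast
  qed
  ultimately show ?thesis by (simp add: bij_def)
qed

lemma frame_op_inv: "S (inv S x) = x" and inv_frame_op: "inv S (S x) = x"
  using bij_frame_op by (simp_all add: bij_is_surj surj_f_inv_f bij_is_inj)

lemma ip_inv_frame_op: "ip (inv S x) y = ip x (inv S y)"
  by (metis ip_frame_op frame_op_inv)

lemma bounded_op_inv_frame_op: "bounded_op scale (inv S)"
proof -
  obtain \<alpha> where \<alpha>: "\<alpha> > 0" "\<And>x. \<alpha> * norm x \<le> norm (S x)" using frame_op_lower_bound by blast
  show ?thesis
  proof (rule bounded_opI)
    show "norm (inv S x) \<le> norm x * (1 / \<alpha>)" for x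
      using \<alpha>(1) \<alpha>(2)[of "inv S x"] by (simp add: frame_op_inv field_simps)
  qed (rule ip_eqI_left, simp add: ip_inv_frame_op ip_add_left ip_scale_left)+
qed

text \<open>Applying \<open>inv S\<close> termwise to the series of \<open>S x\<close> returns x,
  and the part coming from \<open>L\<close> adds the cross term. Both directions between (i) and
  (iii) use this sum.\<close>

lemma dual_candidate_has_sum:
  assumes L: "op_bessel scale I L"
  shows "((\<lambda>i. c i *\<^sub>R (c i *\<^sub>R inv S (proj ip (W i) x) + adj ip (L i) (proj ip (W i) x)))
    has_sum (x + l2_adj ip I (analysis_op I L) (fusion_analysis ip I W c x))) I"
proof -
  have lin: "bounded_linear (inv S)" using bounded_op_inv_frame_op by (rule bounded_opD)
  have "((\<lambda>i. inv S ((c i)\<^sup>2 *\<^sub>R proj ip (W i) x)) has_sum x) I"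
    using has_sum_bounded_linear[OF lin frame_op_has_sum] by (simp add: inv_frame_op)
  from has_sum_add[OF this synthesis_fusion_analysis_has_sum[OF L, of x]] show ?thesis
    by (simp add: linear_cmul[OF bounded_linear.linear[OF lin]] power2_eq_square scaleR_add_right)
qed

end

section \<open>Dual sequences\<close>

context
  fixes I V W Q
  assumes Q: "dual_ops scale ip I V W Q"
begin

lemma bounded_op_dual_ops: "i \<in> I \<Longrightarrow> bounded_op scale (Q i)"
  using Q by (simp add: dual_ops_def)

text \<open>If \<open>V i\<close> is zero, the range is trivial; if \<open>W i\<close> is zero, its
  orthogonal complement is the whole space. This settles the indices at which
  \<open>dual_ops\<close> does not prescribe the norm.\<close>

lemma dual_ops_zero:
  assumes "i \<in> I" "i \<in> zero_indices I V W"
  shows "Q i x = 0"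
proof -
  have "range (Q i) \<subseteq> V i" "ortho ip (W i) \<subseteq> {x. Q i x = 0}"
    using Q assms(1) by (auto simp: dual_ops_def)
  then show ?thesis using assms(2) by (auto simp: zero_indices_def ortho_def)
qed

lemma dual_ops_proj:
  assumes "i \<in> I" "closed_subspace scale (W i)"
  shows "Q i (proj ip (W i) x) = Q i x"
proof -
  have "Q i (x - proj ip (W i) x) = 0"
    using Q assms(1) diff_proj_ortho[OF assms(2), of x] by (auto simp: dual_ops_def)
  then show ?thesis
    using linear_diff[OF bounded_linear.linear[OF bounded_opD(1)[OF bounded_op_dual_ops]]] assms
    by simp
qed

lemma norm_adj_dual_ops_le:
  assumes i: "i \<in> I" and V: "closed_subspace scale (V i)"
  shows "norm (adj ip (Q i) y) \<le> norm (proj ip (V i) y)"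
proof (cases "i \<in> zero_indices I V W")
  case True
  have "adj ip (Q i) y = 0" by (rule adj_eqI) (simp add: dual_ops_zero[OF i True])
  then show ?thesis by simp
next
  case False
  have "Q i x \<in> V i" for x using Q i by (auto simp: dual_ops_def)
  \<comment> \<open>Since \<open>Q i\<close> maps into \<open>V i\<close>, pairing y with
    \<open>Q i x\<close> depends only on the projection of y onto \<open>V i\<close>.\<close>
  then have "adj ip (Q i) y = adj ip (Q i) (proj ip (V i) y)"
    by (intro ip_eqI) (simp add: ip_adj[OF bounded_op_dual_ops[OF i], symmetric] ip_proj_right[OF V])
  then show ?thesis
    using norm_adj_le[OF bounded_op_dual_ops[OF i], of "proj ip (V i) y"] False Q i
    by (simp add: dual_ops_def)
qed

lemma op_bessel_adj_dual_ops:
  assumes V: "bessel_fusion_seq scale ip I V d"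
  shows "op_bessel scale I (\<lambda>i x. d i *\<^sub>R adj ip (Q i) x)"
proof (rule op_bessel_mono)
  show "op_bessel scale I (fusion_ops ip V d)" using V by (simp add: bessel_fusion_seq_def)
  fix i assume i: "i \<in> I"
  then show "bounded_op scale (\<lambda>x. d i *\<^sub>R adj ip (Q i) x)"
    by (intro bounded_op_scaleR bounded_op_adj bounded_op_dual_ops)
  have "closed_subspace scale (V i)"
    using V i by (simp add: bessel_fusion_seq_def fusion_seq_def)
  then show "norm (d i *\<^sub>R adj ip (Q i) x) \<le> norm (fusion_ops ip V d i x)" for x
    using norm_adj_dual_ops_le[OF i] by (simp add: fusion_ops_def mult_left_mono)
qed

end

text \<open>Taking adjoints twice gives back \<open>Q i\<close>, which absorbs the projection onto
  \<open>W i\<close>, so the two series agree term by term. The Bessel condition inside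
  \<open>op_dual\<close> is automatic by \<open>op_bessel_adj_dual_ops\<close>.\<close>

lemma op_dual_iff_has_sum:
  assumes W: "fusion_frame scale ip I W c" and V: "bessel_fusion_seq scale ip I V d"
    and Q: "dual_ops scale ip I V W Q"
  shows "op_dual scale ip I (\<lambda>i x. d i *\<^sub>R adj ip (Q i) x) (fusion_ops ip W c) \<longleftrightarrow>
    (\<forall>x. ((\<lambda>i. (c i * d i) *\<^sub>R Q i x) has_sum x) I)"
proof -
  have "adj ip (\<lambda>x. d i *\<^sub>R adj ip (Q i) x) (fusion_ops ip W c i x) = (c i * d i) *\<^sub>R Q i x"
    if i: "i \<in> I" for i x
  proof -
    have op: "bounded_op scale (Q i)" using Q i by (rule bounded_op_dual_ops)
    have "closed_subspace scale (W i)" using W i by (rule closed_subspace_frame)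
    then show ?thesis
      using dual_ops_proj[OF Q i] linear_cmul[OF bounded_linear.linear[OF bounded_opD(1)[OF op]]]
      by (simp add: adj_scaleR_adj[OF op] fusion_ops_def mult.commute)
  qed
  then have "((\<lambda>i. adj ip (\<lambda>x. d i *\<^sub>R adj ip (Q i) x) (fusion_ops ip W c i x)) has_sum x) I \<longleftrightarrow>
    ((\<lambda>i. (c i * d i) *\<^sub>R Q i x) has_sum x) I" for x
    by (intro has_sum_cong)
  then show ?thesis
    using W op_bessel_adj_dual_ops[OF Q V] by (simp add: op_dual_def fusion_frame_def)
qed

section \<open>The equivalence of (i) and (iii)\<close>

lemma ex_bessel_if_ff_dual:
  assumes "ff_dual scale ip I V d W c"
  shows "\<exists>L. op_bessel scale I L \<and>
    (\<forall>x. l2_adj ip I (analysis_op I L) (fusion_analysis ip I W c x) = 0) \<and>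
    (\<forall>i\<in>I. let A = (\<lambda>x. c i *\<^sub>R inv (fusion_frame_op ip I W c) (proj ip (W i) x)
                        + adj ip (L i) (proj ip (W i) x))
           in range A \<subseteq> V i \<and> (i \<notin> zero_indices I V W \<longrightarrow> onorm A = d i))"
proof -
  obtain Q where V: "bessel_fusion_seq scale ip I V d" and W: "fusion_frame scale ip I W c"
    and Q: "dual_ops scale ip I V W Q"
    and Q_sum: "\<And>x. ((\<lambda>i. (c i * d i) *\<^sub>R Q i x) has_sum x) I"
    using assms by (auto simp: ff_dual_def)
  define R where "R = inv (fusion_frame_op ip I W c)"
  \<comment> \<open>\<open>R\<close> and the projection are self-adjoint, so the adjoint of the
    subtracted term cancels the first summand of the operator \<open>A\<close> in (iii) and leaves
    \<open>d i *\<^sub>R Q i x\<close>.\<close>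
  define L where "L i x = d i *\<^sub>R adj ip (Q i) x - fusion_ops ip W c i (R x)" for i x
  have R: "bounded_op scale R" unfolding R_def using W by (rule bounded_op_inv_frame_op)
  have L: "op_bessel scale I L"
    unfolding L_def
    by (rule op_bessel_diff[OF op_bessel_adj_dual_ops[OF Q V]
          op_bessel_compose[OF op_bessel_fusion_ops[OF W] R]])
  have A: "c i *\<^sub>R R (proj ip (W i) x) + adj ip (L i) (proj ip (W i) x) = d i *\<^sub>R Q i x"
    if i: "i \<in> I" for i x
  proof -
    have op: "bounded_op scale (Q i)" using Q i by (rule bounded_op_dual_ops)
    have Wi: "closed_subspace scale (W i)" using W i by (rule closed_subspace_frame)
    have "adj ip (L i) y = d i *\<^sub>R Q i y - c i *\<^sub>R R (proj ip (W i) y)" for y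
      by (rule adj_eqI)
        (simp add: L_def fusion_ops_def ip_diff_left ip_diff_right ip_scaleR_left ip_scaleR_right
          ip_adj_left[OF op] ip_proj[OF Wi] ip_inv_frame_op[OF W] R_def)
    then show ?thesis
      by (simp add: dual_ops_proj[OF Q i Wi] proj_id[OF Wi proj_mem[OF Wi]])
  qed
  have "l2_adj ip I (analysis_op I L) (fusion_analysis ip I W c x) = 0" for x
  proof -
    have "((\<lambda>i. (c i * d i) *\<^sub>R Q i x) has_sum
        (x + l2_adj ip I (analysis_op I L) (fusion_analysis ip I W c x))) I"
      using dual_candidate_has_sum[OF W L, of x] unfolding R_def [symmetric]
      by (rule has_sum_cong[THEN iffD1, rotated]) (simp add: A)
    \<comment> \<open>The same series sums to x and to x plus the cross term.\<close>
    from has_sum_unique[OF Q_sum this] show ?thesis by simp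
  qed
  moreover have "range (\<lambda>x. d i *\<^sub>R Q i x) \<subseteq> V i \<and>
      (i \<notin> zero_indices I V W \<longrightarrow> onorm (\<lambda>x. d i *\<^sub>R Q i x) = d i)" if i: "i \<in> I" for i
  proof -
    have Vi: "closed_subspace scale (V i)" "0 \<le> d i"
      using V i by (auto simp: bessel_fusion_seq_def fusion_seq_def)
    have "d i *\<^sub>R Q i x \<in> V i" for x
      using Q i Vi subspace_scale[of "V i" "Q i x" "of_real (d i)"]
      by (auto simp: scale_of_real closed_subspace_def dual_ops_def)
    moreover have "onorm (\<lambda>x. d i *\<^sub>R Q i x) = d i" if "i \<notin> zero_indices I V W"
      using Q i Vi that onorm_scaleR[OF bounded_opD(1)[OF bounded_op_dual_ops[OF Q i]], of "d i"]
      by (simp add: dual_ops_def)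
    ultimately show ?thesis by blast
  qed
  ultimately show ?thesis
    unfolding Let_def R_def [symmetric] using L by (intro exI[of _ L]) (simp add: A)
qed

lemma ff_dual_if_bessel:
  assumes W: "fusion_frame scale ip I W c" and V: "bessel_fusion_seq scale ip I V d"
    and L: "op_bessel scale I L"
    and L_zero: "\<And>x. l2_adj ip I (analysis_op I L) (fusion_analysis ip I W c x) = 0"
    and A_def: "\<And>i x. A i x = c i *\<^sub>R inv (fusion_frame_op ip I W c) (proj ip (W i) x)
      + adj ip (L i) (proj ip (W i) x)"
    and A_range: "\<And>i. i \<in> I \<Longrightarrow> range (A i) \<subseteq> V i"
    and A_onorm: "\<And>i. i \<in> I \<Longrightarrow> i \<notin> zero_indices I V W \<Longrightarrow> onorm (A i) = d i"
  shows "ff_dual scale ip I V d W c"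
proof -
  \<comment> \<open>For \<open>d i = 0\<close> the quotient \<open>1 / d i\<close> is 0, so
    \<open>Q i\<close> vanishes there.\<close>
  define Q where "Q i x = (1 / d i) *\<^sub>R A i x" for i x
  have Vi: "closed_subspace scale (V i)" "0 \<le> d i" "d i = 0 \<longleftrightarrow> V i = {0}" if "i \<in> I" for i
    using V that by (auto simp: bessel_fusion_seq_def fusion_seq_def)
  note Wi = closed_subspace_frame[OF W]
  have A_op: "bounded_op scale (A i)" if i: "i \<in> I" for i
  proof -
    have "bounded_op scale (adj ip (L i))"
      using L i by (auto simp: op_bessel_def intro: bounded_op_adj)
    then show ?thesis
      unfolding A_def[abs_def]
      by (intro bounded_op_add bounded_op_scaleR bounded_op_compose[OF _ bounded_op_proj[OF Wi[OF i]]]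
          bounded_op_inv_frame_op[OF W])
  qed
  \<comment> \<open>This includes \<open>d i = 0\<close>: then \<open>V i = {0}\<close>, and the
    range condition forces \<open>A i\<close> to vanish.\<close>
  have QA: "d i *\<^sub>R Q i x = A i x" if i: "i \<in> I" for i x
    using A_range[OF i] Vi(3)[OF i] by (auto simp: Q_def)
  have "dual_ops scale ip I V W Q"
    unfolding dual_ops_def
  proof (intro ballI conjI impI)
    fix i assume i: "i \<in> I"
    show "bounded_op scale (Q i)"
      unfolding Q_def[abs_def] by (intro bounded_op_scaleR A_op i)
    \<comment> \<open>\<open>A i\<close> factors through the projection onto \<open>W i\<close>,
      which annihilates the orthogonal complement.\<close>
    have "A i x = 0" if "x \<in> ortho ip (W i)" for x
    proof -
      have "proj ip (W i) x = 0"
        using Wi[OF i] that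
        by (intro proj_eqI[OF Wi[OF i]]) (auto simp: closed_subspace_def subspace_0)
      then have "A i x = A i 0"
        using proj_id[OF Wi[OF i], of 0] Wi[OF i]
        by (simp add: A_def closed_subspace_def subspace_0)
      then show ?thesis using linear_0[OF bounded_linear.linear[OF bounded_opD(1)[OF A_op[OF i]]]]
        by simp
    qed
    then show "ortho ip (W i) \<subseteq> {x. Q i x = 0}" by (auto simp: Q_def)
    have "Q i x \<in> V i" for x
      using A_range[OF i] Vi(1)[OF i] subspace_scale[of "V i" "A i x" "of_real (1 / d i)"]
      by (auto simp: Q_def scale_of_real closed_subspace_def simp del: of_real_divide)
    then show "range (Q i) \<subseteq> V i" by blast
    assume nz: "i \<notin> zero_indices I V W"
    then have "d i \<noteq> 0" using Vi(3)[OF i] i by (auto simp: zero_indices_def)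
    then show "onorm (Q i) = 1"
      unfolding Q_def[abs_def] onorm_scaleR[OF bounded_opD(1)[OF A_op[OF i]]]
      using A_onorm[OF i nz] Vi(2)[OF i] by simp
  qed
  moreover have "((\<lambda>i. (c i * d i) *\<^sub>R Q i x) has_sum x) I" for x
  proof -
    have "((\<lambda>i. c i *\<^sub>R A i x) has_sum x) I"
      using dual_candidate_has_sum[OF W L, of x] by (simp add: A_def L_zero)
    then show ?thesis
      by (rule has_sum_cong[THEN iffD1, rotated]) (simp add: QA[symmetric])
  qed
  ultimately show ?thesis using V W by (auto simp: ff_dual_def)
qed

end

theorem theorem3p13:
  fixes scale :: "'k::rc_field \<Rightarrow> 'h::{real_inner,banach} \<Rightarrow> 'h"
    and ip :: "'h \<Rightarrow> 'h \<Rightarrow> 'k"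
    and I :: "nat set"
    and W V :: "nat \<Rightarrow> 'h set"
    and c d :: "nat \<Rightarrow> real"
  assumes "hilbert_space scale ip"
    and "fusion_frame scale ip I W c"
    and "bessel_fusion_seq scale ip I V d"
  shows
    "(ff_dual scale ip I V d W c \<longleftrightarrow>
        (\<exists>Q. dual_ops scale ip I V W Q \<and>
             op_dual scale ip I (\<lambda>i x. d i *\<^sub>R adj ip (Q i) x) (fusion_ops ip W c))) \<and>
     (ff_dual scale ip I V d W c \<longleftrightarrow>
        (\<exists>L. op_bessel scale I L \<and>
             (\<forall>x. l2_adj ip I (analysis_op I L) (fusion_analysis ip I W c x) = 0) \<and>
             (\<forall>i\<in>I. let A = (\<lambda>x. c i *\<^sub>R inv (fusion_frame_op ip I W c) (proj ip (W i) x)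
                               + adj ip (L i) (proj ip (W i) x))
                    in range A \<subseteq> V i \<and> (i \<notin> zero_indices I V W \<longrightarrow> onorm A = d i))))"
proof (intro conjI)
  interpret hilbert_space scale ip by fact
  note W = assms(2) and V = assms(3)
  show "ff_dual scale ip I V d W c \<longleftrightarrow>
      (\<exists>Q. dual_ops scale ip I V W Q \<and>
           op_dual scale ip I (\<lambda>i x. d i *\<^sub>R adj ip (Q i) x) (fusion_ops ip W c))"
    using V W op_dual_iff_has_sum[OF W V] by (auto simp: ff_dual_def)
  show "ff_dual scale ip I V d W c \<longleftrightarrow>
      (\<exists>L. op_bessel scale I L \<and>
           (\<forall>x. l2_adj ip I (analysis_op I L) (fusion_analysis ip I W c x) = 0) \<and>
           (\<forall>i\<in>I. let A = (\<lambda>x. c i *\<^sub>R inv (fusion_frame_op ip I W c) (proj ip (W i) x)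
                             + adj ip (L i) (proj ip (W i) x))
                  in range A \<subseteq> V i \<and> (i \<notin> zero_indices I V W \<longrightarrow> onorm A = d i)))"
    (is "_ \<longleftrightarrow> ?bessel")
  proof
    assume ?bessel
    then show "ff_dual scale ip I V d W c"
      \<comment> \<open>Putting \<open>refl\<close> in the place of \<open>A_def\<close>
        instantiates \<open>A\<close> with the operators of (iii).\<close>
      by (elim exE conjE) (rule ff_dual_if_bessel[OF W V _ _ refl], auto simp: Let_def)
  qed (rule ex_bessel_if_ff_dual)
qed

end
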